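(* Let $n\in\mathbb{N}=\{1,2,\dots\}$. Let $I$ be an interval, with $I\subseteq[-\infty,\infty]$ when $n=1$ and $I\subseteq\mathbb{R}$ when $n\neq 1$, let $c\in I$, and let $f,g\colon I\to\mathbb{R}$ be two functions such that (i) the restrictions $f|_{I\cap\mathbb{R}}$ and $g|_{I\cap\mathbb{R}}$ are both $n$-times differentiable, and (ii) $g^{(n)}(x)\neq 0$ for all $x\in I\cap\mathbb{R}$. If $\frac{f^{(n)}}{g^{(n)}}\colon I\cap\mathbb{R}\to\mathbb{R}$ is monotonic (respectively, strictly monotonic), then the function $$\frac{R_{n-1,f,c}}{R_{n-1,g,c}}\colon I\setminus\{c\}\to\mathbb{R}$$ is monotonic (respectively, strictly monotonic) of the same monotonicity (respectively, of the same strict monotonicity), where $R_{n-1,f,c}$ and $R_{n-1,g,c}$ are the Taylor remainders of order $n-1$ at $c$ of $f$ and $g$.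
   Context: Here $[-\infty,\infty]$ is the extended real line, and intervals in it may contain $\pm\infty$. For $m\in\mathbb{N}_0=\{0,1,2,\dots\}$, an interval $I$ (with $I\subseteq[-\infty,\infty]$ when $m=0$ and $I\subseteq\mathbb{R}$ when $m\neq 0$), a point $c\in I$ and a function $f\colon I\to\mathbb{R}$ that is $m$-times differentiable in $I\cap\mathbb{R}$, the Taylor polynomial and the Taylor remainder of order $m$ for $f$ at $c$ are the functions $I\to\mathbb{R}$ given by $$T_{m,f,c}(x)=\sum_{k=0}^m\frac{f^{(k)}(c)}{k!}(x-c)^k,\qquad R_{m,f,c}(x)=f(x)-T_{m,f,c}(x),$$ where the $k=0$ term is $f(c)$, so that $R_{0,f,c}=f-f(c)$. "Of the same monotonicity" means increasing if $\frac{f^{(n)}}{g^{(n)}}$ is increasing and decreasing if it is decreasing, and likewise in the strict case; without "strictly", increasing and decreasing are meant in the weak sense.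
   Formalization: f and g are additionally assumed continuous at any infinite point of I (possible only for n = 1); without this the claim fails, e.g. I = [0,∞], c = 0, f = x², g = x on the reals, f(∞) = 0, g(∞) = 1. *)

theory Defs
  imports "HOL-Analysis.Analysis"
begin

definition ereal_interval :: "ereal set \<Rightarrow> bool" where
  "ereal_interval I \<longleftrightarrow> (\<forall>a\<in>I. \<forall>b\<in>I. {a..b} \<subseteq> I)"

(* Derivatives are taken within S, hence they are one-sided at end points belonging to S. *)

primrec nth_deriv_on :: "nat \<Rightarrow> real set \<Rightarrow> (real \<Rightarrow> real) \<Rightarrow> real \<Rightarrow> real" where
  "nth_deriv_on 0 S f = f"
| "nth_deriv_on (Suc k) S f = (\<lambda>x. vector_derivative (nth_deriv_on k S f) (at x within S))"

definition times_differentiable_on :: "nat \<Rightarrow> (real \<Rightarrow> real) \<Rightarrow> real set \<Rightarrow> bool" where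
  "times_differentiable_on n f S \<longleftrightarrow> (\<forall>k<n. nth_deriv_on k S f differentiable_on S)"

(* A function on I is given by f :: ereal => real, of which only the values on I matter.
   The set of reals belonging to I is the preimage of I under ereal, and f restricted to it
   is f o ereal.  The summand of index 0 is split off because c and x may be infinite when
   m = 0; for m > 0 the Taylor polynomial is meaningful only if I contains no infinite point,
   so that the values of real_of_ereal at infinite points play no role. *)

definition taylor_poly :: "ereal set \<Rightarrow> nat \<Rightarrow> (ereal \<Rightarrow> real) \<Rightarrow> ereal \<Rightarrow> ereal \<Rightarrow> real" where
  "taylor_poly I m f c x =
     f c + (\<Sum>k=1..m. nth_deriv_on k (ereal -` I) (f \<circ> ereal) (real_of_ereal c) / fact k *
                      (real_of_ereal x - real_of_ereal c) ^ k)"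

definition taylor_remainder :: "ereal set \<Rightarrow> nat \<Rightarrow> (ereal \<Rightarrow> real) \<Rightarrow> ereal \<Rightarrow> ereal \<Rightarrow> real" where
  "taylor_remainder I m f c x = f x - taylor_poly I m f c x"

end

theory Submission
  imports Defs
begin

text \<open>
  The theorem is an iterated form of the monotone l'Hospital rule. Let \<open>u\<close> and \<open>v\<close> vanish
  at \<open>c\<close>, and write \<open>q = u' / v'\<close>. Cauchy's mean value theorem on the interval between \<open>c\<close>
  and \<open>x\<close> says that \<open>u x / v x\<close> is a value of \<open>q\<close>. For two points on the same side of \<open>c\<close>,
  say \<open>c < x < y\<close>, it also says that \<open>(u y - u x) / (v y - v x)\<close> is a value of \<open>q\<close>, taken
  farther to the right; since \<open>u y / v y\<close> is a weighted mean of \<open>u x / v x\<close> and this second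
  value, with positive weights, it lies on the same side of \<open>u x / v x\<close> as that value does.
  For \<open>x < c < y\<close> the two ratios are simply values of \<open>q\<close> on the two sides of \<open>c\<close>.
  In every case the increment \<open>u y / v y - u x / v x\<close> has the sign of some increment
  \<open>q \<eta> - q \<xi>\<close> with \<open>\<xi> < \<eta>\<close> and \<open>\<xi>\<close>, \<open>\<eta>\<close> different from \<open>c\<close>
  (\<open>quotient_increments_follow\<close>).

  This property, \<open>increments_follow\<close>, is what makes the argument iterate: it is transitive, and it
  transfers all four kinds of monotonicity at once. The derivative of a Taylor remainder at \<open>c\<close> is
  the remainder, of one order less, of the derivative; it vanishes at \<open>c\<close> again as long as the
  order is not exhausted, and after \<open>n\<close> steps it is the \<open>n\<close>-th derivative itself. So the ratio of
  the remainders follows the ratio of the \<open>n\<close>-th derivatives. The derivative \<open>v'\<close> may change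
  sign at \<open>c\<close> in the intermediate steps, which is why the rule is formulated with hypotheses and
  witnesses away from \<open>c\<close> only.

  Infinite points do no harm in the mean value theorems: \<open>{a..b}\<close> is compact in the extended reals,
  and the points where derivatives are evaluated lie strictly between \<open>a\<close> and \<open>b\<close>, hence are real.
\<close>

section \<open>Mean value theorems on extended intervals\<close>

lemma real_between_ereals:
  assumes "a < x" "x < (b::ereal)"
  obtains t where "x = ereal t"
  using assms by (cases x) auto

text \<open>
  The classical proof: by compactness both extrema are attained, and an interior one is at a real
  point, where the derivative vanishes.
\<close>

lemma rolle_ereal:
  fixes h :: "ereal \<Rightarrow> real" and h' :: "real \<Rightarrow> real"
  assumes ab: "a < b" and eq: "h a = h b"
    and cont: "continuous_on {a..b} h"
    and der: "\<And>t. \<lbrakk>a < ereal t; ereal t < b\<rbrakk> \<Longrightarrow> ((h \<circ> ereal) has_real_derivative h' t) (at t)"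
  shows "\<exists>t. a < ereal t \<and> ereal t < b \<and> h' t = 0"
proof -
  have comp: "compact {a..b}"
    by (simp add: compact_eq_closed)
  have ne: "{a..b} \<noteq> {}"
    using ab by auto
  obtain p where p: "p \<in> {a..b}" "\<forall>z\<in>{a..b}. h z \<le> h p"
    using continuous_attains_sup[OF comp ne cont] by blast
  obtain m where m: "m \<in> {a..b}" "\<forall>z\<in>{a..b}. h m \<le> h z"
    using continuous_attains_inf[OF comp ne cont] by blast
  obtain s where s: "a < ereal s" "ereal s < b"
    using ereal_dense2[OF ab] by blast
  have "\<exists>x. a < x \<and> x < b \<and> ((\<forall>z\<in>{a..b}. h z \<le> h x) \<or> (\<forall>z\<in>{a..b}. h x \<le> h z))"
  proof (cases "(a < p \<and> p < b) \<or> (a < m \<and> m < b)")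
    case True
    then show ?thesis using p m by blast
  next
    case False
    \<comment> \<open>Both extrema sit at end points, so the function is constant and any interior point will do.\<close>
    then have "h p = h a" "h m = h a"
      using p(1) m(1) eq by (auto simp: less_le)
    then have "\<forall>z\<in>{a..b}. h z \<le> h (ereal s)"
      using p(2) m(2) s by (metis atLeastAtMost_iff dual_order.antisym less_imp_le order_refl)
    then show ?thesis using s by blast
  qed
  then obtain x where x: "a < x" "x < b"
    and ext: "(\<forall>z\<in>{a..b}. h z \<le> h x) \<or> (\<forall>z\<in>{a..b}. h x \<le> h z)"
    by blast
  obtain t where t: "x = ereal t"
    using x by (rule real_between_ereals)
  have "open (ereal -` {a<..<b})"
    by (rule open_ereal_vimage) simp
  moreover have "t \<in> ereal -` {a<..<b}"
    using x t by simp
  ultimately obtain d where d: "d > 0" "ball t d \<subseteq> ereal -` {a<..<b}"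
    by (meson open_contains_ball)
  have near: "ereal y \<in> {a..b}" if "\<bar>t - y\<bar> < d" for y
    using d(2) that by (force simp: dist_real_def subset_iff intro: less_imp_le)
  note D = der[of t, folded t, OF x]
  from ext have "h' t = 0"
  proof
    assume "\<forall>z\<in>{a..b}. h z \<le> h x"
    then show ?thesis
      using DERIV_local_max[OF D d(1)] near t by simp
  next
    assume "\<forall>z\<in>{a..b}. h x \<le> h z"
    then show ?thesis
      using DERIV_local_min[OF D d(1)] near t by simp
  qed
  then show ?thesis using x t by blast
qed

lemma cauchy_mean_value_ereal:
  fixes u v :: "ereal \<Rightarrow> real" and u' v' :: "real \<Rightarrow> real"
  assumes ab: "a < b"
    and cont: "continuous_on {a..b} u" "continuous_on {a..b} v"
    and du: "\<And>t. \<lbrakk>a < ereal t; ereal t < b\<rbrakk> \<Longrightarrow> ((u \<circ> ereal) has_real_derivative u' t) (at t)"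
    and dv: "\<And>t. \<lbrakk>a < ereal t; ereal t < b\<rbrakk> \<Longrightarrow> ((v \<circ> ereal) has_real_derivative v' t) (at t)"
    and nz: "\<And>t. \<lbrakk>a < ereal t; ereal t < b\<rbrakk> \<Longrightarrow> v' t \<noteq> 0"
  shows "v a \<noteq> v b"
    and "\<exists>t. a < ereal t \<and> ereal t < b \<and> u b - u a = u' t / v' t * (v b - v a)"
proof -
  show "v a \<noteq> v b"
    using rolle_ereal[OF ab _ cont(2) dv] nz by blast
  \<comment> \<open>This combination takes equal values at the end points.\<close>
  define h where "h = (\<lambda>x. (u b - u a) * v x - (v b - v a) * u x)"
  have "h a = h b"
    by (simp add: h_def algebra_simps)
  moreover have "continuous_on {a..b} h"
    unfolding h_def by (intro continuous_intros cont)
  moreover have "((h \<circ> ereal) has_real_derivative (u b - u a) * v' t - (v b - v a) * u' t) (at t)"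
    if "a < ereal t" "ereal t < b" for t
    using du[OF that] dv[OF that] unfolding h_def o_def
    by (auto intro!: derivative_eq_intros)
  ultimately obtain t where "a < ereal t" "ereal t < b" "(u b - u a) * v' t - (v b - v a) * u' t = 0"
    using rolle_ereal[OF ab, of h "\<lambda>t. (u b - u a) * v' t - (v b - v a) * u' t"] by blast
  moreover from this have "u b - u a = u' t / v' t * (v b - v a)"
    using nz by (simp add: field_simps)
  ultimately show "\<exists>t. a < ereal t \<and> ereal t < b \<and> u b - u a = u' t / v' t * (v b - v a)"
    by blast
qed

section \<open>Increments of a quotient and of the quotient of derivatives\<close>

text \<open>
  Only signs of increments are compared, so that one relation serves weak and strict, increasing and
  decreasing functions alike, and the two functions may live on different orders.
\<close>

definition increments_follow ::
    "('a::linorder \<Rightarrow> real) \<Rightarrow> 'a set \<Rightarrow> ('b::linorder \<Rightarrow> real) \<Rightarrow> 'b set \<Rightarrow> bool" where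
  "increments_follow r A q B \<longleftrightarrow>
     (\<forall>x\<in>A. \<forall>y\<in>A. x < y \<longrightarrow> (\<exists>\<xi>\<in>B. \<exists>\<eta>\<in>B. \<xi> < \<eta> \<and> sgn (r y - r x) = sgn (q \<eta> - q \<xi>)))"

lemma increments_follow_trans:
  assumes "increments_follow r A q B" "increments_follow q B p C"
  shows "increments_follow r A p C"
  using assms unfolding increments_follow_def by metis

lemma increments_follow_mono_sets:
  assumes "increments_follow r A q B" "A' \<subseteq> A" "B \<subseteq> B'"
  shows "increments_follow r A' q B'"
  using assms unfolding increments_follow_def by (meson subsetD)

lemma increments_follow_refl: "increments_follow q A q A"
  unfolding increments_follow_def by blast

lemma increments_follow_imp_monotonicity:
  assumes "increments_follow r A q B"
  shows "mono_on B q \<Longrightarrow> mono_on A r"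
    and "antimono_on B q \<Longrightarrow> antimono_on A r"
    and "strict_mono_on B q \<Longrightarrow> strict_mono_on A r"
    and "strict_antimono_on B q \<Longrightarrow> strict_antimono_on A r"
proof -
  have sgnD: "(a \<le> b \<longleftrightarrow> a' \<le> b') \<and> (b \<le> a \<longleftrightarrow> b' \<le> a')"
    if "sgn (b - a) = sgn (b' - a')" for a b a' b' :: real
    using that by (auto simp: sgn_if split: if_splits)
  have wit: "\<exists>\<xi>\<in>B. \<exists>\<eta>\<in>B. \<xi> < \<eta> \<and> (r x \<le> r y \<longleftrightarrow> q \<xi> \<le> q \<eta>) \<and> (r y \<le> r x \<longleftrightarrow> q \<eta> \<le> q \<xi>)"
    if "x \<in> A" "y \<in> A" "x < y" for x y
    using assms that sgnD unfolding increments_follow_def by metis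
  show "mono_on A r" if q: "mono_on B q"
    unfolding monotone_on_def
  proof safe
    fix x y assume "x \<in> A" "y \<in> A" "x \<le> y"
    then show "r x \<le> r y"
      using wit[of x y] monotone_onD[OF q] by (cases "x = y") (auto simp: less_le)
  qed
  show "antimono_on A r" if q: "antimono_on B q"
    unfolding monotone_on_def
  proof safe
    fix x y assume "x \<in> A" "y \<in> A" "x \<le> y"
    then show "r y \<le> r x"
      using wit[of x y] monotone_onD[OF q] by (cases "x = y") (auto simp: less_le)
  qed
  show "strict_mono_on A r" if q: "strict_mono_on B q"
    unfolding monotone_on_def
  proof safe
    fix x y assume "x \<in> A" "y \<in> A" "x < y"
    then show "r x < r y"
      using wit[of x y] monotone_onD[OF q] by (auto simp: not_le[symmetric])
  qed
  show "strict_antimono_on A r" if q: "strict_antimono_on B q"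
    unfolding monotone_on_def
  proof safe
    fix x y assume "x \<in> A" "y \<in> A" "x < y"
    then show "r y < r x"
      using wit[of x y] monotone_onD[OF q] by (auto simp: not_le[symmetric])
  qed
qed

text \<open>
  The weighted mean argument. The number \<open>p\<close> is the ratio at the point \<open>z\<close> nearer to the centre,
  and \<open>q\<close> is the ratio of the increments from \<open>z\<close> to the farther point \<open>w\<close>. The ratio at \<open>w\<close> is
  the mean of \<open>p\<close> and \<open>q\<close> with weights \<open>vz / vw\<close> and \<open>1 - vz / vw\<close>.
\<close>

lemma sgn_quotient_increment:
  fixes uz uw vz vw p q :: real
  assumes uz: "uz = p * vz" and inc: "uw - uz = q * (vw - vz)"
    and v: "0 < vz \<and> vz < vw \<or> vw < vz \<and> vz < 0"
  shows "sgn (uw / vw - uz / vz) = sgn (q - p)"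
proof -
  have "uw / vw - uz / vz = (1 - vz / vw) * (q - p)"
    using assms by (auto simp: field_simps)
  moreover have "1 - vz / vw > 0"
    using v by (auto simp: field_simps)
  ultimately show ?thesis
    by (simp add: sgn_mult)
qed

text \<open>
  One step of the monotone l'Hospital rule. The sign condition that the weighted mean argument needs
  comes from Rolle's theorem: on each side of \<open>c\<close> the function \<open>v\<close> is injective and continuous,
  hence strictly monotonic, and it vanishes at \<open>c\<close>.
\<close>

lemma quotient_increments_follow:
  fixes u v u1 v1 :: "ereal \<Rightarrow> real"
  assumes I: "ereal_interval I" and c: "c \<in> I"
    and cont: "continuous_on I u" "continuous_on I v"
    and zero: "u c = 0" "v c = 0"
    and du: "\<And>t. ereal t \<in> I - {c} \<Longrightarrow>
               ((u \<circ> ereal) has_real_derivative u1 (ereal t)) (at t within ereal -` I)"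
    and dv: "\<And>t. ereal t \<in> I - {c} \<Longrightarrow>
               ((v \<circ> ereal) has_real_derivative v1 (ereal t)) (at t within ereal -` I)"
    and nz: "\<And>t. ereal t \<in> I - {c} \<Longrightarrow> v1 (ereal t) \<noteq> 0"
  shows "\<forall>x\<in>I - {c}. v x \<noteq> 0"
    and "increments_follow (\<lambda>x. u x / v x) (I - {c}) (\<lambda>x. u1 x / v1 x) (I \<inter> range ereal - {c})"
proof -
  define q where "q = (\<lambda>x. u1 x / v1 x)"
  define B where "B = I \<inter> range ereal - {c}"
  have sub: "{a..b} \<subseteq> I" if "a \<in> I" "b \<in> I" for a b
    using I that by (auto simp: ereal_interval_def)
  have mvt: "v a \<noteq> v b \<and> (\<exists>\<xi>\<in>B. a < \<xi> \<and> \<xi> < b \<and> u b - u a = q \<xi> * (v b - v a))"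
    if ab: "a \<in> I" "b \<in> I" "a < b" and nc: "\<not> (a < c \<and> c < b)" for a b
  proof -
    have inI: "ereal t \<in> I - {c}" if "a < ereal t" "ereal t < b" for t
      using that nc sub[OF ab(1,2)] by (auto simp: less_imp_le)
    have at: "at t within ereal -` I = at t" if "a < ereal t" "ereal t < b" for t
    proof (rule at_within_open_subset)
      show "t \<in> ereal -` {a<..<b}" "open (ereal -` {a<..<b})"
        using that by (auto intro: open_ereal_vimage)
      show "ereal -` {a<..<b} \<subseteq> ereal -` I"
        using sub[OF ab(1,2)] greaterThanLessThan_subseteq_atLeastAtMost_iff[of a b a b]
        by (intro vimage_mono) (blast intro: order_trans)
    qed
    have D: "((u \<circ> ereal) has_real_derivative u1 (ereal t)) (at t)"
         "((v \<circ> ereal) has_real_derivative v1 (ereal t)) (at t)"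
      if "a < ereal t" "ereal t < b" for t
      using du[OF inI[OF that]] dv[OF inI[OF that]] unfolding at[OF that] by auto
    have C: "continuous_on {a..b} u" "continuous_on {a..b} v"
      using cont sub[OF ab(1,2)] continuous_on_subset by blast+
    note * = cauchy_mean_value_ereal[OF ab(3) C, of "u1 \<circ> ereal" "v1 \<circ> ereal", unfolded o_def,
        OF D[unfolded o_def] nz[OF inI]]
    have "v a \<noteq> v b"
      by (rule *(1))
    moreover obtain t where "a < ereal t" "ereal t < b"
        "u b - u a = u1 (ereal t) / v1 (ereal t) * (v b - v a)"
      using *(2) by blast
    ultimately show ?thesis
      using inI by (force simp: q_def B_def)
  qed
  have vne: "v x \<noteq> v y" if "x \<in> I" "y \<in> I" "x \<noteq> y" "c \<le> x \<and> c \<le> y \<or> x \<le> c \<and> y \<le> c" for x y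
  proof (cases "x < y")
    case True
    then show ?thesis using mvt[of x y] that by (meson leD)
  next
    case False
    then have "y < x" using \<open>x \<noteq> y\<close> by simp
    then show ?thesis using mvt[of y x] that by (metis leD)
  qed
  show "\<forall>x\<in>I - {c}. v x \<noteq> 0"
    using vne[of c] c zero by force
  show "increments_follow (\<lambda>x. u x / v x) (I - {c}) (\<lambda>x. u1 x / v1 x) (I \<inter> range ereal - {c})"
    unfolding increments_follow_def q_def[symmetric] B_def[symmetric]
  proof (intro ballI impI)
    fix x y assume x: "x \<in> I - {c}" and y: "y \<in> I - {c}" and xy: "x < y"
    have v0: "v x \<noteq> 0" "v y \<noteq> 0"
      using vne[of c] x y c zero by force+
    consider "c < x" | "y < c" | "x < c" "c < y"
      using x y by fastforce
    then show "\<exists>\<xi>\<in>B. \<exists>\<eta>\<in>B. \<xi> < \<eta> \<and> sgn (u y / v y - u x / v x) = sgn (q \<eta> - q \<xi>)"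
    proof cases
      case 1
      obtain \<xi> where \<xi>: "\<xi> \<in> B" "\<xi> < x" "u x = q \<xi> * v x"
        using mvt[of c x] x c 1 zero by auto
      obtain \<eta> where \<eta>: "\<eta> \<in> B" "x < \<eta>" "u y - u x = q \<eta> * (v y - v x)"
        using mvt[of x y] x y xy less_asym[OF 1] by blast
      have "inj_on v {c..y}"
      proof (rule inj_onI)
        fix s t assume "s \<in> {c..y}" "t \<in> {c..y}" "v s = v t"
        then show "s = t"
          using vne[of s t] sub[of c y] c y by (auto simp: subset_iff)
      qed
      then have "0 < v x \<and> v x < v y \<or> v y < v x \<and> v x < 0"
        using continuous_inj_imp_mono[OF 1 xy, of v] sub[of c y] c y zero
          continuous_on_subset[OF cont(2)] by auto
      then show ?thesis
        using sgn_quotient_increment[OF \<xi>(3) \<eta>(3)] \<xi> \<eta> by (meson less_trans)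
    next
      case 2
      obtain \<eta> where \<eta>: "\<eta> \<in> B" "y < \<eta>" "u y = q \<eta> * v y"
        using mvt[of y c] y c 2 zero by auto
      obtain \<xi> where \<xi>: "\<xi> \<in> B" "\<xi> < y" "u y - u x = q \<xi> * (v y - v x)"
        using mvt[of x y] x y xy less_asym[OF 2] by blast
      have \<xi>': "u x - u y = q \<xi> * (v x - v y)"
        using \<xi>(3) by (simp add: algebra_simps)
      have "inj_on v {x..c}"
      proof (rule inj_onI)
        fix s t assume "s \<in> {x..c}" "t \<in> {x..c}" "v s = v t"
        then show "s = t"
          using vne[of s t] sub[of x c] c x by (auto simp: subset_iff)
      qed
      then have "0 < v y \<and> v y < v x \<or> v x < v y \<and> v y < 0"
        using continuous_inj_imp_mono[OF xy 2, of v] sub[of x c] c x zero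
          continuous_on_subset[OF cont(2)] by auto
      \<comment> \<open>Here the point nearer to the centre is the larger one, so both increments change sign.\<close>
      from sgn_quotient_increment[OF \<eta>(3) \<xi>' this]
      have "sgn (u y / v y - u x / v x) = sgn (q \<eta> - q \<xi>)"
        by (metis minus_diff_eq sgn_minus)
      then show ?thesis
        using \<xi> \<eta> by (meson less_trans)
    next
      case 3
      obtain \<xi> where \<xi>: "\<xi> \<in> B" "\<xi> < c" "u x = q \<xi> * v x"
        using mvt[of x c] x c 3 zero by auto
      obtain \<eta> where \<eta>: "\<eta> \<in> B" "c < \<eta>" "u y = q \<eta> * v y"
        using mvt[of c y] y c 3 zero by auto
      have "u y / v y - u x / v x = q \<eta> - q \<xi>"
        using \<xi>(3) \<eta>(3) v0 by simp
      then show ?thesis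
        using \<xi> \<eta> by (metis less_trans)
    qed
  qed
qed

section \<open>Derivatives of Taylor remainders\<close>

text \<open>
  Limits at a real point can be taken along real arguments, because the infinite points of \<open>I\<close> stay
  away from it.
\<close>

lemma at_within_ereal: "at (ereal t) within I = filtermap ereal (at t within ereal -` I)"
  by (auto simp: filter_eq_iff eventually_filtermap eventually_at_filter nhds_ereal)

text \<open>
  Order zero is treated apart because \<open>f\<close> has its own values at the infinite points.
\<close>

definition deriv_ereal :: "ereal set \<Rightarrow> (ereal \<Rightarrow> real) \<Rightarrow> nat \<Rightarrow> ereal \<Rightarrow> real" where
  "deriv_ereal I f k x =
     (if k = 0 then f x else nth_deriv_on k (ereal -` I) (f \<circ> ereal) (real_of_ereal x))"

lemma deriv_ereal_real [simp]:
  "deriv_ereal I f k (ereal t) = nth_deriv_on k (ereal -` I) (f \<circ> ereal) t"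
  by (simp add: deriv_ereal_def)

text \<open>
  For \<open>k < n\<close> this is the Taylor remainder of order \<open>n - 1 - k\<close> at \<open>c\<close> of the \<open>k\<close>-th derivative
  of \<open>f\<close>, hence the \<open>k\<close>-th derivative of the remainder of order \<open>n - 1\<close>. The sum is over
  \<open>j < n - k\<close> so that it is empty for \<open>k = n\<close> and the \<open>n\<close>-th derivative itself ends the chain.
\<close>

definition deriv_remainder ::
    "ereal set \<Rightarrow> nat \<Rightarrow> (ereal \<Rightarrow> real) \<Rightarrow> ereal \<Rightarrow> nat \<Rightarrow> ereal \<Rightarrow> real" where
  "deriv_remainder I n f c k x = deriv_ereal I f k x -
     (\<Sum>j<n - k. deriv_ereal I f (k + j) c / fact j * (real_of_ereal x - real_of_ereal c) ^ j)"

lemma deriv_remainder_0: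
  assumes "n \<ge> 1"
  shows "deriv_remainder I n f c 0 = taylor_remainder I (n - 1) f c"
proof
  fix x
  obtain m where n: "n = Suc m"
    using assms by (cases n) auto
  show "deriv_remainder I n f c 0 x = taylor_remainder I (n - 1) f c x"
    unfolding deriv_remainder_def taylor_remainder_def taylor_poly_def n
    by (simp add: sum.lessThan_Suc_shift sum.atLeast1_atMost_eq deriv_ereal_def del: sum.lessThan_Suc)
qed

lemma deriv_remainder_self: "deriv_remainder I n f c n = deriv_ereal I f n"
  by (simp add: deriv_remainder_def fun_eq_iff)

lemma deriv_remainder_center:
  assumes "k < n"
  shows "deriv_remainder I n f c k c = 0"
proof -
  obtain m where "n - k = Suc m"
    using assms by (metis Suc_diff_Suc)
  then show ?thesis
    by (simp add: deriv_remainder_def sum.lessThan_Suc_shift del: sum.lessThan_Suc)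
qed

lemma deriv_remainder_has_derivative:
  assumes diff: "times_differentiable_on n (f \<circ> ereal) (ereal -` I)"
    and k: "k < n" and t: "ereal t \<in> I"
  shows "((deriv_remainder I n f c k \<circ> ereal) has_real_derivative
           deriv_remainder I n f c (Suc k) (ereal t)) (at t within ereal -` I)"
proof -
  define S where "S = ereal -` I"
  define a where "a = (\<lambda>j. deriv_ereal I f (k + j) c)"
  define d where "d = real_of_ereal c"
  obtain m where m: "n - k = Suc m" "n - Suc k = m"
    using k by (metis Suc_diff_Suc)
  have "nth_deriv_on k S (f \<circ> ereal) differentiable (at t within S)"
    using diff k t by (auto simp: times_differentiable_on_def differentiable_on_def S_def)
  then have D: "(nth_deriv_on k S (f \<circ> ereal) has_real_derivative
                   nth_deriv_on (Suc k) S (f \<circ> ereal) t) (at t within S)"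
    by (simp add: has_real_derivative_iff_has_vector_derivative vector_derivative_works)
  have cancel: "b / (N * F) * (N * p) = b / F * p" if "N \<noteq> 0" for b N F p :: real
    using that by simp
  have P: "((\<lambda>x. \<Sum>j<m. a (Suc j) / fact (Suc j) * (x - d) ^ Suc j) has_real_derivative
          (\<Sum>j<m. a (Suc j) / fact j * (t - d) ^ j)) (at t within S)"
  proof (rule DERIV_sum)
    fix j
    have "((\<lambda>x. a (Suc j) / fact (Suc j) * (x - d) ^ Suc j) has_real_derivative
           a (Suc j) / fact (Suc j) * (real (Suc j) * (t - d) ^ j)) (at t within S)"
      by (auto intro!: derivative_eq_intros simp del: power_Suc fact_Suc)
    moreover have "a (Suc j) / fact (Suc j) * (real (Suc j) * (t - d) ^ j) = a (Suc j) / fact j * (t - d) ^ j"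
      unfolding fact_Suc by (rule cancel) simp
    ultimately show "((\<lambda>x. a (Suc j) / fact (Suc j) * (x - d) ^ Suc j) has_real_derivative
           a (Suc j) / fact j * (t - d) ^ j) (at t within S)"
      by metis
  qed
  have "deriv_remainder I n f c k \<circ> ereal = (\<lambda>x. nth_deriv_on k S (f \<circ> ereal) x -
          (a 0 + (\<Sum>j<m. a (Suc j) / fact (Suc j) * (x - d) ^ Suc j)))"
    by (simp add: fun_eq_iff deriv_remainder_def m sum.lessThan_Suc_shift a_def d_def S_def
        del: sum.lessThan_Suc power_Suc fact_Suc)
  moreover have "deriv_remainder I n f c (Suc k) (ereal t) =
      nth_deriv_on (Suc k) S (f \<circ> ereal) t - (0 + (\<Sum>j<m. a (Suc j) / fact j * (t - d) ^ j))"
    by (simp add: deriv_remainder_def m a_def d_def S_def)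
  ultimately show ?thesis
    using DERIV_diff[OF D DERIV_add[OF DERIV_const[of "a 0"] P]] by (simp only: S_def)
qed

text \<open>
  At real points continuity follows from differentiability; an infinite point occurs only for
  \<open>n = 1\<close>, and then the remainder is \<open>f - f c\<close>.
\<close>

lemma deriv_remainder_continuous:
  assumes diff: "times_differentiable_on n (f \<circ> ereal) (ereal -` I)"
    and k: "k < n" and fin: "n \<noteq> 1 \<Longrightarrow> I \<subseteq> range ereal"
    and inf: "\<forall>x\<in>I \<inter> {-\<infinity>, \<infinity>}. continuous (at x within I) f"
  shows "continuous_on I (deriv_remainder I n f c k)"
  unfolding continuous_on_eq_continuous_within
proof
  fix x assume x: "x \<in> I"
  show "continuous (at x within I) (deriv_remainder I n f c k)"
  proof (cases "x \<in> range ereal")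
    case True
    then obtain t where t: "x = ereal t" by blast
    have "((deriv_remainder I n f c k \<circ> ereal) \<longlongrightarrow>
            (deriv_remainder I n f c k \<circ> ereal) t) (at t within ereal -` I)"
      using deriv_remainder_has_derivative[OF diff k] x t DERIV_continuous continuous_within
      by blast
    then have "(deriv_remainder I n f c k \<longlongrightarrow> deriv_remainder I n f c k x) (at x within I)"
      unfolding t at_within_ereal filterlim_filtermap by (simp add: o_def)
    then show ?thesis
      by (simp add: continuous_within)
  next
    case False
    then have "n = 1"
      using fin x by blast
    moreover have "x \<in> I \<inter> {-\<infinity>, \<infinity>}"
      using False x by (cases x) auto
    moreover have "deriv_remainder I 1 f c 0 = (\<lambda>x. f x - f c)"
      by (simp add: deriv_remainder_def deriv_ereal_def fun_eq_iff)
    ultimately show ?thesis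
      using k inf by (auto intro!: continuous_intros)
  qed
qed

section \<open>Monotonicity of ratios of Taylor remainders\<close>

theorem theorem4:
  fixes n :: nat and I :: "ereal set" and c :: ereal and f g :: "ereal \<Rightarrow> real"
  defines "S \<equiv> ereal -` I"
  defines "q \<equiv> (\<lambda>x. nth_deriv_on n S (f \<circ> ereal) x / nth_deriv_on n S (g \<circ> ereal) x)"
  defines "r \<equiv> (\<lambda>x. taylor_remainder I (n - 1) f c x / taylor_remainder I (n - 1) g c x)"
  assumes "n \<ge> 1"
    and "ereal_interval I"
    and "n \<noteq> 1 \<Longrightarrow> I \<subseteq> range ereal"
    and "c \<in> I"
    and "times_differentiable_on n (f \<circ> ereal) S"
    and "times_differentiable_on n (g \<circ> ereal) S"
    and "\<forall>x\<in>S. nth_deriv_on n S (g \<circ> ereal) x \<noteq> 0"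
    and "\<forall>x \<in> I \<inter> {-\<infinity>, \<infinity>}. continuous (at x within I) f \<and> continuous (at x within I) g"
  shows "(\<forall>x \<in> I - {c}. taylor_remainder I (n - 1) g c x \<noteq> 0) \<and>
         (mono_on S q \<longrightarrow> mono_on (I - {c}) r) \<and>
         (antimono_on S q \<longrightarrow> antimono_on (I - {c}) r) \<and>
         (strict_mono_on S q \<longrightarrow> strict_mono_on (I - {c}) r) \<and>
         (strict_antimono_on S q \<longrightarrow> strict_antimono_on (I - {c}) r)"
proof -
  define \<rho> where "\<rho> = deriv_remainder I n f c"
  define \<sigma> where "\<sigma> = deriv_remainder I n g c"
  \<comment> \<open>Intermediate steps live on the real points; the last one, at \<open>k = 0\<close>, reaches all of \<open>I\<close>.\<close>
  define A where "A = I \<inter> range ereal - {c}"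
  have step: "(\<forall>x\<in>I - {c}. \<sigma> k x \<noteq> 0) \<and>
      increments_follow (\<lambda>x. \<rho> k x / \<sigma> k x) (I - {c}) (\<lambda>x. \<rho> (Suc k) x / \<sigma> (Suc k) x) A"
    if k: "k < n" and nz: "\<forall>x\<in>A. \<sigma> (Suc k) x \<noteq> 0" for k
  proof -
    have D: "((\<rho> k \<circ> ereal) has_real_derivative \<rho> (Suc k) (ereal t)) (at t within ereal -` I)"
      "((\<sigma> k \<circ> ereal) has_real_derivative \<sigma> (Suc k) (ereal t)) (at t within ereal -` I)"
      if "ereal t \<in> I - {c}" for t
      using that deriv_remainder_has_derivative[OF _ k] assms
      unfolding \<rho>_def \<sigma>_def S_def by blast+
    have C: "continuous_on I (\<rho> k)" "continuous_on I (\<sigma> k)"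
      using deriv_remainder_continuous[OF _ k] assms unfolding \<rho>_def \<sigma>_def S_def by blast+
    have Z: "\<rho> k c = 0" "\<sigma> k c = 0"
      using deriv_remainder_center[OF k] unfolding \<rho>_def \<sigma>_def by blast+
    have nz': "\<sigma> (Suc k) (ereal t) \<noteq> 0" if "ereal t \<in> I - {c}" for t
      using nz that by (auto simp: A_def)
    show ?thesis
      using quotient_increments_follow[OF \<open>ereal_interval I\<close> \<open>c \<in> I\<close> C Z D nz']
      unfolding A_def by blast
  qed
  have "(\<forall>x\<in>A. \<sigma> k x \<noteq> 0) \<and>
      increments_follow (\<lambda>x. \<rho> k x / \<sigma> k x) A (\<lambda>x. \<rho> n x / \<sigma> n x) A" if "k \<le> n" for k
    using that
  proof (induction rule: inc_induct)
    case base
    have "\<sigma> n x \<noteq> 0" if "x \<in> A" for x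
    proof -
      obtain t where "x = ereal t" "t \<in> S"
        using \<open>x \<in> A\<close> unfolding A_def S_def by blast
      then show ?thesis
        using assms(10) by (simp add: \<sigma>_def S_def deriv_remainder_self)
    qed
    then show ?case
      by (simp add: increments_follow_refl)
  next
    case (step k)
    have "A \<subseteq> I - {c}" by (auto simp: A_def)
    then show ?case
      using \<open>\<And>k. k < n \<Longrightarrow> \<forall>x\<in>A. \<sigma> (Suc k) x \<noteq> 0 \<Longrightarrow> _\<close>[OF \<open>k < n\<close>] step.IH
        increments_follow_trans increments_follow_mono_sets by blast
  qed
  from this[of 1] have one: "\<forall>x\<in>A. \<sigma> (Suc 0) x \<noteq> 0"
      "increments_follow (\<lambda>x. \<rho> (Suc 0) x / \<sigma> (Suc 0) x) A (\<lambda>x. \<rho> n x / \<sigma> n x) A"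
    using \<open>n \<ge> 1\<close> by auto
  have last: "\<forall>x\<in>I - {c}. \<sigma> 0 x \<noteq> 0"
      "increments_follow (\<lambda>x. \<rho> 0 x / \<sigma> 0 x) (I - {c}) (\<lambda>x. \<rho> n x / \<sigma> n x) A"
    using step[of 0] one \<open>n \<ge> 1\<close> increments_follow_trans by auto
  have "increments_follow (\<lambda>x. \<rho> n x / \<sigma> n x) A q S"
    unfolding increments_follow_def
  proof (intro ballI impI)
    fix x y assume "x \<in> A" "y \<in> A" "x < y"
    moreover from this obtain s t where "x = ereal s" "y = ereal t"
      unfolding A_def by blast
    ultimately have "s \<in> S" "t \<in> S" "s < t"
        "\<rho> n y / \<sigma> n y - \<rho> n x / \<sigma> n x = q t - q s"
      by (auto simp: A_def S_def q_def \<rho>_def \<sigma>_def deriv_remainder_self)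
    then show "\<exists>\<xi>\<in>S. \<exists>\<eta>\<in>S. \<xi> < \<eta> \<and>
        sgn (\<rho> n y / \<sigma> n y - \<rho> n x / \<sigma> n x) = sgn (q \<eta> - q \<xi>)"
      by metis
  qed
  from increments_follow_trans[OF last(2) this]
  have "increments_follow r (I - {c}) q S"
    using \<open>n \<ge> 1\<close> by (simp add: r_def \<rho>_def \<sigma>_def deriv_remainder_0)
  from increments_follow_imp_monotonicity[OF this] last(1) show ?thesis
    using \<open>n \<ge> 1\<close> by (auto simp: \<sigma>_def deriv_remainder_0)
qed

end
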